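(* Let $k,l\ge1$ and let $M$ be the immersion of $S^k\times S^l\times\mathbb{R}$ in $S^{k+l+2}$ given by $$\varphi(y,z,u)=\left(\sqrt{1-f_1^2(u)-f_2^2(u)}\;y,\;f_2(u)\,z,\;f_1(u)\right),$$ where $y\in S^k$, $z\in S^l$ and $(f_1(u),f_2(u))$ defines an immersion of $S^1$, with $f_1$ and $f_2$ smooth $T$-periodic functions satisfying $f_1'(u)^2+f_2'(u)^2=1$, $f_2(u)>0$ and $f_1(u)^2+f_2(u)^2<1$ for all $u$. Then for any smooth function $\zeta:M\to\mathbb{R}$, $$\Delta\zeta=\frac{\Delta_{S^k}\zeta}{f^2}+\frac{1}{1+(f')^2}\left(\left(k\frac{f'}{f}+l\frac{f_2'}{f_2}-\frac{f'f''}{1+(f')^2}\right)\frac{\partial\zeta}{\partial u}+\frac{\partial^2\zeta}{\partial u^2}\right)+\frac{\Delta_{S^l}\zeta}{f_2^2},$$ where $\Delta_{S^k}$ is the Laplacian on the $k$-dimensional unit sphere (acting in $y$) and $\Delta_{S^l}$ is the Laplacian on the $l$-dimensional unit sphere (acting in $z$).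
   Context: $S^k\subset\mathbb{R}^{k+1}$ and $S^l\subset\mathbb{R}^{l+1}$ are unit spheres, and $f(u)=\sqrt{1-f_1(u)^2-f_2(u)^2}$. Functions on $M$ are regarded as functions of $(y,z,u)$, $T$-periodic in $u$, and $\Delta=\operatorname{div}\nabla$ is the Laplace operator of the metric induced by $\varphi$. *)

theory Defs
  imports "HOL-Analysis.Analysis"
begin

section \<open>Smooth maps\<close>

text \<open>\<open>C_n_on n U F\<close>: all iterated directional derivatives of \<open>F\<close> of order less than \<open>n\<close> are
  differentiable on the open set \<open>U\<close>, and those of order \<open>n\<close> are continuous there.\<close>

primrec C_n_on ::
  "nat \<Rightarrow> 'a::real_normed_vector set \<Rightarrow> ('a \<Rightarrow> 'b::real_normed_vector) \<Rightarrow> bool"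
where
  "C_n_on 0 U F \<longleftrightarrow> continuous_on U F"
| "C_n_on (Suc n) U F \<longleftrightarrow>
     (\<forall>x\<in>U. F differentiable (at x)) \<and>
     (\<forall>v. C_n_on n U (\<lambda>x. frechet_derivative F (at x) v))"

definition C_inf_on ::
  "'a::real_normed_vector set \<Rightarrow> ('a \<Rightarrow> 'b::real_normed_vector) \<Rightarrow> bool"
where "C_inf_on U F \<longleftrightarrow> (\<forall>n. C_n_on n U F)"

text \<open>Smoothness of a map on an arbitrary subset of a Euclidean space: local existence of
  smooth extensions.\<close>

definition smooth_map_on ::
  "'a::real_normed_vector set \<Rightarrow> ('a \<Rightarrow> 'b::real_normed_vector) \<Rightarrow> bool"
where
  "smooth_map_on S F \<longleftrightarrow>
     (\<forall>p\<in>S. \<exists>U G. open U \<and> p \<in> U \<and> C_inf_on U G \<and> (\<forall>q\<in>U \<inter> S. G q = F q))"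

section \<open>Riemannian geometry on an embedded submanifold\<close>

text \<open>Throughout, \<open>S\<close> is (the carrier of) an embedded submanifold of a Euclidean space, and a
  Riemannian metric on it is a family \<open>g p\<close> of inner products on the tangent spaces
  \<open>tangent_space S p\<close>; values of \<open>g p\<close> on other vectors are irrelevant. The metric need not be
  the one inherited from the surrounding Euclidean space.\<close>

type_synonym 'a metric_tensor = "'a \<Rightarrow> 'a \<Rightarrow> 'a \<Rightarrow> real"

definition tangent_space :: "'a::real_normed_vector set \<Rightarrow> 'a \<Rightarrow> 'a set"
where
  "tangent_space S p =
     {v. \<exists>c e. 0 < e \<and> C_inf_on {-e<..<e} c \<and> c ` {-e<..<e} \<subseteq> S \<and> c 0 = p \<and>
               (c has_vector_derivative v) (at (0::real))}"

text \<open>The differential at \<open>p\<close> of a map on \<open>S\<close>. The derivative within \<open>S\<close> is in general not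
  unique as a linear map on the whole surrounding space, but by the chain rule along curves in
  \<open>S\<close> its values on \<open>tangent_space S p\<close> are; it is only used on such vectors.\<close>

abbreviation differential ::
  "'a::real_normed_vector set \<Rightarrow> ('a \<Rightarrow> 'b::real_normed_vector) \<Rightarrow> 'a \<Rightarrow> 'a \<Rightarrow> 'b"
where "differential S F p \<equiv> frechet_derivative F (at p within S)"

definition induced_metric ::
  "'a::real_normed_vector set \<Rightarrow> ('a \<Rightarrow> 'b::real_inner) \<Rightarrow> 'a metric_tensor"
where "induced_metric S F p v w = differential S F p v \<bullet> differential S F p w"

definition smooth_vector_field :: "'a::real_normed_vector set \<Rightarrow> ('a \<Rightarrow> 'a) \<Rightarrow> bool"
where
  "smooth_vector_field S X \<longleftrightarrow> smooth_map_on S X \<and> (\<forall>p\<in>S. X p \<in> tangent_space S p)"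

text \<open>For vector fields tangent to \<open>S\<close> the bracket is again tangent to \<open>S\<close>, and it is the
  intrinsic Lie bracket of \<open>S\<close>.\<close>

definition lie_bracket ::
  "'a::real_normed_vector set \<Rightarrow> ('a \<Rightarrow> 'a) \<Rightarrow> ('a \<Rightarrow> 'a) \<Rightarrow> 'a \<Rightarrow> 'a"
where
  "lie_bracket S X Y p = differential S Y p (X p) - differential S X p (Y p)"

text \<open>The right-hand side of the Koszul formula, that is, \<open>2 * g (\<nabla>\<^sub>X Y) Z\<close> for the Levi-Civita
  connection \<open>\<nabla>\<close> of \<open>g\<close>.\<close>

definition koszul ::
  "'a::real_normed_vector set \<Rightarrow> 'a metric_tensor \<Rightarrow> ('a \<Rightarrow> 'a) \<Rightarrow> ('a \<Rightarrow> 'a) \<Rightarrow> ('a \<Rightarrow> 'a) \<Rightarrow> 'a \<Rightarrow> real"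
where
  "koszul S g X Y Z p =
     differential S (\<lambda>q. g q (Y q) (Z q)) p (X p)
   + differential S (\<lambda>q. g q (X q) (Z q)) p (Y p)
   - differential S (\<lambda>q. g q (X q) (Y q)) p (Z p)
   + g p (lie_bracket S X Y p) (Z p)
   - g p (lie_bracket S X Z p) (Y p)
   - g p (lie_bracket S Y Z p) (X p)"

text \<open>\<open>levi_civita S g v Y p\<close> is the covariant derivative at \<open>p\<close> of the vector field \<open>Y\<close> in the
  direction of the tangent vector \<open>v\<close>; \<open>X\<close> ranges over all vector fields extending \<open>v\<close>.\<close>

definition levi_civita ::
  "'a::real_normed_vector set \<Rightarrow> 'a metric_tensor \<Rightarrow> 'a \<Rightarrow> ('a \<Rightarrow> 'a) \<Rightarrow> 'a \<Rightarrow> 'a"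
where
  "levi_civita S g v Y p =
     (THE w. w \<in> tangent_space S p \<and>
        (\<forall>X Z. smooth_vector_field S X \<and> smooth_vector_field S Z \<and> X p = v \<longrightarrow>
               2 * g p w (Z p) = koszul S g X Y Z p))"

definition gradient ::
  "'a::real_normed_vector set \<Rightarrow> 'a metric_tensor \<Rightarrow> ('a \<Rightarrow> real) \<Rightarrow> 'a \<Rightarrow> 'a"
where
  "gradient S g h p =
     (THE w. w \<in> tangent_space S p \<and>
        (\<forall>v\<in>tangent_space S p. g p w v = differential S h p v))"

text \<open>The trace of an endomorphism \<open>A\<close> of a finite-dimensional subspace \<open>W\<close>, computed in
  some basis of \<open>W\<close>.\<close>

definition trace_on :: "'a::real_vector set \<Rightarrow> ('a \<Rightarrow> 'a) \<Rightarrow> real"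
where
  "trace_on W A =
     (let B = (SOME B. independent B \<and> span B = W) in \<Sum>b\<in>B. representation B (A b) b)"

definition divergence ::
  "'a::real_normed_vector set \<Rightarrow> 'a metric_tensor \<Rightarrow> ('a \<Rightarrow> 'a) \<Rightarrow> 'a \<Rightarrow> real"
where "divergence S g Y p = trace_on (tangent_space S p) (\<lambda>v. levi_civita S g v Y p)"

definition laplacian ::
  "'a::real_normed_vector set \<Rightarrow> 'a metric_tensor \<Rightarrow> ('a \<Rightarrow> real) \<Rightarrow> 'a \<Rightarrow> real"
where "laplacian S g h p = divergence S g (gradient S g h) p"

text \<open>The Laplacian of the unit sphere with its round metric, which is the metric induced by
  the inclusion.\<close>

definition sphere_laplacian :: "('a::euclidean_space \<Rightarrow> real) \<Rightarrow> 'a \<Rightarrow> real"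
where "sphere_laplacian = laplacian (sphere 0 1) (\<lambda>p v w. v \<bullet> w)"

end

theory Submission
  imports Defs
begin

text \<open>The metric induced by \<open>\<phi>\<close> is the multiply warped product
  \<open>f\<^sup>2 g\<^bsub>S\<^sup>k\<^esub> + f\<^sub>2\<^sup>2 g\<^bsub>S\<^sup>l\<^esub> + (1 + f'\<^sup>2) du\<^sup>2\<close>, since
  \<open>f\<^sub>1'\<^sup>2 + f\<^sub>2'\<^sup>2 = 1\<close>. It is the restriction to tangent vectors of a symmetric form \<open>G\<close> that makes
  sense on all vectors of the ambient space, where the Koszul formula can be evaluated with the
  flat derivative: every bracket term cancels and
  \<open>2 G(\<nabla>\<^sub>X Y, Z) = 2 G(Y' X, Z) + (X G)(Y, Z) + (Y G)(X, Z) - (Z G)(X, Y)\<close>.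
  The covariant derivative read off from this extends to a linear map of the ambient space with values
  in the tangent space, whose trace is a sum over the ambient basis and so splits along the three factors.
  Applied to the gradient
  \<open>(grad\<^bsub>S\<^sup>k\<^esub> \<zeta> / a, grad\<^bsub>S\<^sup>l\<^esub> \<zeta> / b, \<zeta>\<^sub>u / c)\<close> of a warped metric with coefficients
  \<open>a(u), b(u), c(u)\<close> this gives the formula.\<close>

section \<open>Smooth maps and tangent spaces\<close>

lemma frechet_derivative_eq:
  "(F has_derivative F') (at x) \<Longrightarrow> frechet_derivative F (at x) = F'"
  by (rule frechet_derivative_at[symmetric])

lemma C_n_on_cong:
  assumes "open U" "\<And>x. x \<in> U \<Longrightarrow> F x = G x"
  shows "C_n_on n U F \<Longrightarrow> C_n_on n U G"
  using assms
proof (induction n arbitrary: F G)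
  case 0
  then show ?case by (simp cong: continuous_on_cong)
next
  case (Suc n)
  have G: "(G has_derivative frechet_derivative F (at x)) (at x)" if "x \<in> U" for x
  proof (rule has_derivative_transform_within_open)
    show "(F has_derivative frechet_derivative F (at x)) (at x)"
      using Suc.prems(1) that by (simp add: frechet_derivative_works)
  qed (use Suc.prems that in auto)
  then have "frechet_derivative F (at x) = frechet_derivative G (at x)" if "x \<in> U" for x
    using that by (metis frechet_derivative_eq)
  moreover have "\<forall>x\<in>U. G differentiable at x"
    using G by (auto simp: differentiable_def)
  ultimately show ?case
    using Suc.prems Suc.IH[of "\<lambda>x. frechet_derivative F (at x) _" "\<lambda>x. frechet_derivative G (at x) _"]
    by simp
qed

text \<open>On an open set any explicitly known derivative may stand in for the chosen
  \<open>frechet_derivative\<close>; the closure rules below then follow by induction from the usual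
  differentiation rules.\<close>

lemma C_n_on_SucI:
  assumes "open U" "\<And>x. x \<in> U \<Longrightarrow> (F has_derivative F' x) (at x)"
    and "\<And>v. C_n_on n U (\<lambda>x. F' x v)"
  shows "C_n_on (Suc n) U F"
proof -
  have "C_n_on n U (\<lambda>x. frechet_derivative F (at x) v)" for v
    by (rule C_n_on_cong[OF \<open>open U\<close> _ assms(3)]) (use assms(2) frechet_derivative_eq in fastforce)
  with assms(2) show ?thesis
    by (auto simp: differentiable_def)
qed

lemma C_n_on_SucD:
  assumes "C_n_on (Suc n) U F"
  shows "\<And>x. x \<in> U \<Longrightarrow> (F has_derivative frechet_derivative F (at x)) (at x)"
    and "\<And>v. C_n_on n U (\<lambda>x. frechet_derivative F (at x) v)"
  using assms by (auto simp: frechet_derivative_works)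

text \<open>For the product rule, whose terms keep one factor undifferentiated and so need it one
  level lower.\<close>

lemma C_n_on_Suc_imp: "C_n_on (Suc n) U F \<Longrightarrow> C_n_on n U F"
proof (induction n arbitrary: F)
  case 0
  then show ?case
    by (auto intro!: continuous_at_imp_continuous_on differentiable_imp_continuous_within)
next
  case (Suc n)
  then show ?case by (metis C_n_on.simps(2))
qed

lemma C_n_on_subset: "C_n_on n U F \<Longrightarrow> V \<subseteq> U \<Longrightarrow> C_n_on n V F"
  by (induction n arbitrary: F) (auto intro: continuous_on_subset)

lemma C_n_on_const: "C_n_on n U (\<lambda>x. c)"
  by (induction n arbitrary: c) auto

lemma C_n_on_bounded_linear:
  assumes "open U" "bounded_linear L" "C_n_on n U F"
  shows "C_n_on n U (\<lambda>x. L (F x))"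
  using assms(3)
proof (induction n arbitrary: F)
  case 0
  then show ?case
    using bounded_linear.continuous_on[OF assms(2)] by simp
next
  case (Suc n)
  note D = C_n_on_SucD[OF Suc.prems]
  show ?case
    by (rule C_n_on_SucI[OF \<open>open U\<close> bounded_linear.has_derivative[OF assms(2) D(1)] Suc.IH[OF D(2)]])
qed

lemma C_n_on_ident: "open U \<Longrightarrow> C_n_on n U (\<lambda>x. x)"
  by (cases n) (auto simp del: C_n_on.simps(2) intro!: C_n_on_SucI[OF _ has_derivative_ident C_n_on_const])

lemma C_n_on_add:
  assumes "open U" "C_n_on n U F" "C_n_on n U G"
  shows "C_n_on n U (\<lambda>x. F x + G x)"
  using assms(2,3)
proof (induction n arbitrary: F G)
  case 0
  then show ?case by (auto intro: continuous_intros)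
next
  case (Suc n)
  note D = C_n_on_SucD[OF Suc.prems(1)] and E = C_n_on_SucD[OF Suc.prems(2)]
  show ?case
    by (rule C_n_on_SucI[OF \<open>open U\<close> has_derivative_add[OF D(1) E(1)] Suc.IH[OF D(2) E(2)]])
qed

lemma C_n_on_scaleR:
  fixes F :: "'a::real_normed_vector \<Rightarrow> real"
  assumes "open U" "C_n_on n U F" "C_n_on n U G"
  shows "C_n_on n U (\<lambda>x. F x *\<^sub>R G x)"
  using assms(2,3)
proof (induction n arbitrary: F G)
  case 0
  then show ?case by (auto intro: continuous_intros)
next
  case (Suc n)
  note D = C_n_on_SucD[OF Suc.prems(1)] and E = C_n_on_SucD[OF Suc.prems(2)]
  have "C_n_on n U (\<lambda>x. F x *\<^sub>R frechet_derivative G (at x) v)"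
    and "C_n_on n U (\<lambda>x. frechet_derivative F (at x) v *\<^sub>R G x)" for v
    using Suc.IH[OF C_n_on_Suc_imp[OF Suc.prems(1)] E(2)]
      Suc.IH[OF D(2) C_n_on_Suc_imp[OF Suc.prems(2)]] by this
  then show ?case
    using C_n_on_SucI[OF \<open>open U\<close> has_derivative_scaleR[OF D(1) E(1)]] C_n_on_add[OF \<open>open U\<close>]
    by blast
qed

lemma C_n_on_Pair:
  assumes "open U" "C_n_on n U F" "C_n_on n U G"
  shows "C_n_on n U (\<lambda>x. (F x, G x))"
  using assms(2,3)
proof (induction n arbitrary: F G)
  case 0
  then show ?case by (auto intro: continuous_intros)
next
  case (Suc n)
  note D = C_n_on_SucD[OF Suc.prems(1)] and E = C_n_on_SucD[OF Suc.prems(2)]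
  show ?case
    by (rule C_n_on_SucI[OF \<open>open U\<close> has_derivative_Pair[OF D(1) E(1)] Suc.IH[OF D(2) E(2)]])
qed

text \<open>Differentiation only changes the two coefficients \<open>b\<close> and \<open>c\<close>,
  so the induction runs over all of them at once. It supplies the smoothness of great
  circles.\<close>

lemma C_n_on_cos_sin:
  fixes a b c :: real
  assumes "open U"
  shows "C_n_on n U (\<lambda>t. b * cos (a * t) + c * sin (a * t))"
proof (induction n arbitrary: b c)
  case 0
  then show ?case by (auto intro!: continuous_intros)
next
  case (Suc n)
  show ?case
  proof (rule C_n_on_SucI[OF assms])
    show "((\<lambda>t. b * cos (a * t) + c * sin (a * t)) has_derivative
      (\<lambda>h. (c * a * h) * cos (a * x) + (- b * a * h) * sin (a * x))) (at x)" for x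
      by (auto intro!: derivative_eq_intros simp: fun_eq_iff algebra_simps)
  qed (rule Suc)
qed

lemma C_inf_on_has_real_derivative:
  fixes F :: "real \<Rightarrow> real"
  assumes "C_inf_on UNIV F"
  shows "(F has_real_derivative deriv F u) (at u)"
    and "(deriv F has_real_derivative deriv (deriv F) u) (at u)"
proof -
  have "C_n_on (Suc (Suc 0)) UNIV F"
    using assms unfolding C_inf_on_def by blast
  note F = C_n_on_SucD[OF this]
  have 1: "(F has_real_derivative deriv F x) (at x)" for x
    using F(1) by (metis DERIV_deriv_iff_real_differentiable UNIV_I differentiable_def)
  then show "(F has_real_derivative deriv F u) (at u)" .
  have "frechet_derivative F (at x) = (*) (deriv F x)" for x
    using 1[of x] unfolding has_field_derivative_def by (rule frechet_derivative_eq)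
  then have "deriv F = (\<lambda>x. frechet_derivative F (at x) 1)"
    by (simp add: fun_eq_iff)
  then have "deriv F differentiable (at u)"
    using C_n_on_SucD(1)[OF F(2)[of 1], of u] by (auto simp: differentiable_def)
  then show "(deriv F has_real_derivative deriv (deriv F) u) (at u)"
    by (simp add: DERIV_deriv_iff_real_differentiable)
qed

section \<open>Tangent spaces, differentials on tangent vectors, and traces\<close>

lemma tangent_spaceI:
  assumes "0 < e" "C_inf_on {-e<..<e} c" "\<And>t. t \<in> {-e<..<e} \<Longrightarrow> c t \<in> S" "c 0 = p"
    "(c has_vector_derivative v) (at (0::real))"
  shows "v \<in> tangent_space S p"
  unfolding tangent_space_def using assms by blast

lemma tangent_spaceE:
  assumes "v \<in> tangent_space S p"
  obtains c e where "0 < e" "C_inf_on {-e<..<e} c" "\<And>t. t \<in> {-e<..<e} \<Longrightarrow> c t \<in> S" "c 0 = p"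
    "(c has_vector_derivative v) (at (0::real))"
  using assms unfolding tangent_space_def by blast

text \<open>Derivatives within \<open>S\<close> may differ on vectors that are not tangent. Composed
  with a curve in \<open>S\<close> of velocity \<open>v\<close>, each of them computes the velocity
  at 0 of the same curve \<open>F \<circ> c\<close>, which is unique.\<close>

lemma has_derivative_within_tangent_unique:
  assumes "(F has_derivative F') (at p within S)" "v \<in> tangent_space S p"
  shows "differential S F p v = F' v"
proof -
  obtain c e where c: "0 < e" "c ` {-e<..<e} \<subseteq> S" "c 0 = p" "(c has_vector_derivative v) (at (0::real))"
    using assms(2) by (auto simp: tangent_space_def)
  have *: "((F \<circ> c) has_vector_derivative D v) (at 0)"
    if "(F has_derivative D) (at p within S)" for D
  proof -
    have "(c has_derivative (\<lambda>h. h *\<^sub>R v)) (at 0 within {-e<..<e})"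
      using c(4) by (simp add: has_vector_derivative_def has_derivative_at_withinI)
    moreover have "(F has_derivative D) (at (c 0) within c ` {-e<..<e})"
      using that c has_derivative_subset by blast
    ultimately have "((F \<circ> c) has_derivative (D \<circ> (\<lambda>h. h *\<^sub>R v))) (at 0 within {-e<..<e})"
      by (rule diff_chain_within)
    moreover have "D \<circ> (\<lambda>h. h *\<^sub>R v) = (\<lambda>h. h *\<^sub>R D v)"
      using has_derivative_bounded_linear[OF that]
      by (auto simp: linear_simps fun_eq_iff)
    ultimately show ?thesis
      using c(1) by (simp add: has_vector_derivative_def at_within_open[of 0 "{-e<..<e}"])
  qed
  have "(F has_derivative differential S F p) (at p within S)"
    using assms(1) frechet_derivative_works differentiable_def by blast
  from vector_derivative_unique_at[OF *[OF this] *[OF assms(1)]] show ?thesis .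
qed

lemma smooth_map_on_has_derivative:
  assumes "smooth_map_on S F" "p \<in> S"
  obtains F' where "(F has_derivative F') (at p within S)"
proof -
  obtain U G where U: "open U" "p \<in> U" "C_inf_on U G" "\<And>q. q \<in> U \<inter> S \<Longrightarrow> G q = F q"
    using assms by (auto simp: smooth_map_on_def)
  have "C_n_on (Suc 0) U G"
    using U(3) by (auto simp: C_inf_on_def)
  then have "(G has_derivative frechet_derivative G (at p)) (at p within S)"
    using C_n_on_SucD(1) U(2) has_derivative_at_withinI by blast
  moreover have "eventually (\<lambda>q. G q = F q) (at p within S)"
    using U by (auto simp: eventually_at_topological)
  ultimately have "(F has_derivative frechet_derivative G (at p)) (at p within S)"
    by (rule has_derivative_transform_eventually) (use U assms in auto)
  then show ?thesis by (rule that)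
qed

lemma tangent_space_Times:
  fixes S :: "'a::real_normed_vector set" and S' :: "'b::real_normed_vector set"
  shows "tangent_space (S \<times> S') (p, p') = tangent_space S p \<times> tangent_space S' p'"
proof (intro equalityI subsetI)
  fix v assume "v \<in> tangent_space (S \<times> S') (p, p')"
  then obtain c e where c: "0 < e" "C_inf_on {-e<..<e} c" "\<And>t. t \<in> {-e<..<e} \<Longrightarrow> c t \<in> S \<times> S'"
    "c 0 = (p, p')" "(c has_vector_derivative v) (at (0::real))"
    by (rule tangent_spaceE) blast
  have "fst v \<in> tangent_space S p"
  proof (rule tangent_spaceI[OF c(1)])
    show "C_inf_on {-e<..<e} (\<lambda>t. fst (c t))"
      using c(2) C_n_on_bounded_linear[OF open_greaterThanLessThan bounded_linear_fst]
      unfolding C_inf_on_def by blast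
    show "((\<lambda>t. fst (c t)) has_vector_derivative fst v) (at 0)"
      by (rule bounded_linear.has_vector_derivative[OF bounded_linear_fst c(5)])
  qed (use c(3,4) in \<open>auto simp: mem_Times_iff\<close>)
  moreover have "snd v \<in> tangent_space S' p'"
  proof (rule tangent_spaceI[OF c(1)])
    show "C_inf_on {-e<..<e} (\<lambda>t. snd (c t))"
      using c(2) C_n_on_bounded_linear[OF open_greaterThanLessThan bounded_linear_snd]
      unfolding C_inf_on_def by blast
    show "((\<lambda>t. snd (c t)) has_vector_derivative snd v) (at 0)"
      by (rule bounded_linear.has_vector_derivative[OF bounded_linear_snd c(5)])
  qed (use c(3,4) in \<open>auto simp: mem_Times_iff\<close>)
  ultimately show "v \<in> tangent_space S p \<times> tangent_space S' p'"
    by (simp add: mem_Times_iff)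
next
  fix w assume "w \<in> tangent_space S p \<times> tangent_space S' p'"
  then obtain v v' where w: "w = (v, v')" "v \<in> tangent_space S p" "v' \<in> tangent_space S' p'"
    by auto
  obtain c e where c: "0 < e" "C_inf_on {-e<..<e} c" "\<And>t. t \<in> {-e<..<e} \<Longrightarrow> c t \<in> S" "c 0 = p"
    "(c has_vector_derivative v) (at (0::real))"
    by (rule tangent_spaceE[OF w(2)]) blast
  obtain c' e' where c': "0 < e'" "C_inf_on {-e'<..<e'} c'" "\<And>t. t \<in> {-e'<..<e'} \<Longrightarrow> c' t \<in> S'"
    "c' 0 = p'" "(c' has_vector_derivative v') (at (0::real))"
    by (rule tangent_spaceE[OF w(3)]) blast
  define d where "d = min e e'"
  have d: "0 < d" "{-d<..<d} \<subseteq> {-e<..<e}" "{-d<..<d} \<subseteq> {-e'<..<e'}"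
    using c c' by (auto simp: d_def)
  show "w \<in> tangent_space (S \<times> S') (p, p')"
  proof (rule tangent_spaceI[OF d(1)])
    have "C_n_on n {-d<..<d} c" "C_n_on n {-d<..<d} c'" for n
      using c(2) c'(2) d C_n_on_subset unfolding C_inf_on_def by blast+
    then show "C_inf_on {-d<..<d} (\<lambda>t. (c t, c' t))"
      unfolding C_inf_on_def by (simp add: C_n_on_Pair)
    show "((\<lambda>t. (c t, c' t)) has_vector_derivative w) (at 0)"
      using c(5) c'(5) w(1) by (simp add: has_vector_derivative_Pair)
  qed (use c(3,4) c'(3,4) d in auto)
qed

lemma tangent_space_UNIV: "tangent_space UNIV p = UNIV"
proof -
  have "v \<in> tangent_space UNIV p" for v
    unfolding tangent_space_def
    by (auto intro!: exI[of _ "\<lambda>t. p + t *\<^sub>R v"] exI[of _ 1] derivative_eq_intros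
        C_n_on_add C_n_on_scaleR C_n_on_const C_n_on_ident simp: C_inf_on_def)
  then show ?thesis by auto
qed

lemma tangent_space_sphere:
  fixes p :: "'a::euclidean_space"
  assumes "p \<in> sphere 0 1"
  shows "tangent_space (sphere 0 1) p = {v. v \<bullet> p = 0}"
proof (intro equalityI subsetI)
  have p: "p \<bullet> p = 1"
    using assms by (simp add: dot_square_norm)
  fix v assume "v \<in> tangent_space (sphere 0 1) p"
  then obtain c e where c: "0 < e" "c ` {-e<..<e} \<subseteq> sphere 0 1" "c 0 = p"
    "(c has_vector_derivative v) (at (0::real))"
    by (auto simp: tangent_space_def)
  have "((\<lambda>t. c t \<bullet> c t) has_vector_derivative (p \<bullet> v + v \<bullet> p)) (at 0)"
    using c(3,4) by (auto simp: has_vector_derivative_def algebra_simps intro!: derivative_eq_intros)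
  moreover have "c t \<bullet> c t = 1" if "t \<in> {-e<..<e}" for t
    using c(2) that by (force simp: dot_square_norm)
  then have "((\<lambda>t. c t \<bullet> c t) has_vector_derivative 0) (at 0)"
    using c(1) by (intro has_vector_derivative_transform_within_open
        [OF has_vector_derivative_const[of 1], of "{-e<..<e}"]) auto
  ultimately have "p \<bullet> v + v \<bullet> p = 0"
    using vector_derivative_unique_at by blast
  then show "v \<in> {v. v \<bullet> p = 0}"
    by (simp add: inner_commute)
next
  have p: "p \<bullet> p = 1"
    using assms by (simp add: dot_square_norm)
  fix v assume "v \<in> {v. v \<bullet> p = 0}"
  then have v: "v \<bullet> p = 0" "p \<bullet> v = 0" by (auto simp: inner_commute)
  \<comment> \<open>The great circle through \<open>p\<close> with velocity \<open>v\<close>, run at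
    angular speed \<open>a\<close>. For \<open>v = 0\<close> the quotient is 0 and the curve is
    constantly \<open>p\<close>.\<close>
  define a where "a = norm v"
  define c where "c t = cos (a * t) *\<^sub>R p + sin (a * t) *\<^sub>R (v /\<^sub>R a)" for t
  have "C_inf_on UNIV (\<lambda>t. cos (a * t))" "C_inf_on UNIV (\<lambda>t. sin (a * t))"
    using C_n_on_cos_sin[OF open_UNIV, of _ 1 a 0] C_n_on_cos_sin[OF open_UNIV, of _ 0 a 1]
    by (auto simp: C_inf_on_def)
  then have cs: "C_n_on n {-1<..<1} (\<lambda>t. cos (a * t))" "C_n_on n {-1<..<1} (\<lambda>t. sin (a * t))" for n
    unfolding C_inf_on_def using C_n_on_subset[OF _ subset_UNIV] by blast+
  have "C_inf_on {-1<..<1} c"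
    unfolding C_inf_on_def c_def
    by (intro allI C_n_on_add C_n_on_scaleR C_n_on_const cs) auto
  moreover have "c t \<bullet> c t = 1" for t
  proof (cases "v = 0")
    case False
    define w where "w = v /\<^sub>R a"
    have "w \<bullet> w = 1" "w \<bullet> p = 0" "p \<bullet> w = 0"
      using False v by (auto simp: w_def a_def dot_square_norm power2_eq_square)
    then have "c t \<bullet> c t = (cos (a * t))\<^sup>2 + (sin (a * t))\<^sup>2"
      by (simp add: c_def w_def[symmetric] inner_simps p power2_eq_square)
    then show ?thesis by simp
  qed (simp add: c_def a_def p)
  then have "c ` {-1<..<1} \<subseteq> sphere 0 1"
    by (auto simp: norm_eq_sqrt_inner)
  moreover have "c 0 = p"
    by (simp add: c_def)
  moreover have "(c has_vector_derivative v) (at 0)"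
  proof -
    have "a *\<^sub>R (v /\<^sub>R a) = v"
      by (cases "v = 0") (auto simp: a_def)
    moreover have "(c has_vector_derivative a *\<^sub>R (v /\<^sub>R a)) (at 0)"
      unfolding c_def by (auto intro!: derivative_eq_intros)
    ultimately show ?thesis by simp
  qed
  ultimately show "v \<in> tangent_space (sphere 0 1) p"
    unfolding tangent_space_def by (auto intro!: exI[of _ c] exI[of _ 1])
qed

text \<open>A map with range in \<open>W\<close> has the same trace on the whole space as on
  \<open>W\<close>. Expanding \<open>L i\<close> in \<open>B\<close> and exchanging the two sums
  shows this for whichever basis \<open>SOME\<close> picks, with no need to complete
  \<open>B\<close> to a basis of the ambient space.\<close>

lemma trace_on_eq_sum_Basis:
  fixes W :: "'a::euclidean_space set"
  assumes W: "subspace W" and L: "linear L" "\<And>v. L v \<in> W" and A: "\<And>v. v \<in> W \<Longrightarrow> A v = L v"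
  shows "trace_on W A = (\<Sum>i\<in>Basis. L i \<bullet> i)"
proof -
  define B where "B = (SOME B. independent B \<and> span B = W)"
  have "\<exists>B. independent B \<and> span B = W"
    using basis_exists[of W] W by (metis span_eq_iff span_mono subset_antisym)
  then have B: "independent B" "span B = W"
    unfolding B_def by (metis (mono_tags, lifting) someI_ex)+
  have fin: "finite B"
    using B(1) by (rule independent_imp_finite)
  have "(\<Sum>i\<in>Basis. L i \<bullet> i) = (\<Sum>i\<in>Basis. (\<Sum>b\<in>B. representation B (L i) b *\<^sub>R b) \<bullet> i)"
    using sum_representation_eq[OF B(1) _ fin subset_refl] B(2) L(2) by simp
  also have "\<dots> = (\<Sum>b\<in>B. \<Sum>i\<in>Basis. (b \<bullet> i) * representation B (L i) b)"
    by (subst sum.swap) (simp add: inner_sum_left mult.commute)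
  also have "\<dots> = (\<Sum>b\<in>B. representation B (\<Sum>i\<in>Basis. (b \<bullet> i) *\<^sub>R L i) b)"
    using B L(2) by (simp add: representation_sum representation_scale span_scale subspace_scale[OF W])
  also have "\<dots> = (\<Sum>b\<in>B. representation B (L b) b)"
  proof -
    have "(\<Sum>i\<in>Basis. (b \<bullet> i) *\<^sub>R L i) = L b" for b
      using euclidean_representation[of b] L(1) by (metis (no_types, lifting) linear_sum linear_cmul sum.cong)
    then show ?thesis by simp
  qed
  also have "\<dots> = (\<Sum>b\<in>B. representation B (A b) b)"
    using A B(2) by (intro sum.cong) (auto simp: span_base)
  finally show ?thesis
    by (simp add: trace_on_def B_def Let_def)
qed

section \<open>Metrics that extend to the ambient space\<close>

text \<open>\<open>G\<close> is the ambient extension of \<open>g\<close>, and \<open>DG p h\<close> is its derivative at \<open>p\<close> in direction \<open>h\<close>.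
  Since \<open>g\<close> is only known on tangent vectors, brackets of tangent fields have to be tangent.\<close>

locale embedded_riemannian =
  fixes S :: "'a::euclidean_space set" and g G :: "'a metric_tensor" and DG :: "'a \<Rightarrow> 'a metric_tensor"
  assumes subspace_tangent: "p \<in> S \<Longrightarrow> subspace (tangent_space S p)"
    and extension: "\<lbrakk>p \<in> S; v \<in> tangent_space S p\<rbrakk> \<Longrightarrow> \<exists>X. smooth_vector_field S X \<and> X p = v"
    and bracket_tangent: "\<lbrakk>p \<in> S; \<forall>q\<in>S. X q \<in> tangent_space S q;
      \<forall>q\<in>S. Y q \<in> tangent_space S q;
      (X has_derivative X') (at p within S); (Y has_derivative Y') (at p within S)\<rbrakk>
      \<Longrightarrow> Y' (X p) - X' (Y p) \<in> tangent_space S p"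
    and g_eq: "\<lbrakk>p \<in> S; v \<in> tangent_space S p; w \<in> tangent_space S p\<rbrakk> \<Longrightarrow> g p v w = G p v w"
    and G_commute: "G p v w = G p w v"
    and G_diff_left: "G p (v - v') w = G p v w - G p v' w"
    and G_pos: "\<lbrakk>p \<in> S; v \<noteq> 0\<rbrakk> \<Longrightarrow> G p v v > 0"
    and G_derivative: "\<lbrakk>p \<in> S; (V has_derivative V') (at p within S); (W has_derivative W') (at p within S)\<rbrakk>
      \<Longrightarrow> ((\<lambda>q. G q (V q) (W q)) has_derivative
            (\<lambda>h. DG p h (V p) (W p) + G p (V' h) (W p) + G p (V p) (W' h))) (at p within S)"
begin

text \<open>The three differentiated products give six terms with a derivative of a field, the three
  brackets another six; by symmetry of \<open>G\<close> all cancel except two copies of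
  \<open>G p (Y' (X p)) (Z p)\<close>. Neither \<open>X'\<close> nor \<open>Z'\<close> survives, so
  the Koszul expression depends on \<open>X\<close> and \<open>Z\<close> only through their values
  at \<open>p\<close>. \<open>G\<close> is essential here because \<open>Y' (X p)\<close> need not
  be tangent.\<close>

lemma koszul_eq:
  assumes p: "p \<in> S"
    and X: "\<forall>q\<in>S. X q \<in> tangent_space S q" "(X has_derivative X') (at p within S)"
    and Y: "\<forall>q\<in>S. Y q \<in> tangent_space S q" "(Y has_derivative Y') (at p within S)"
    and Z: "\<forall>q\<in>S. Z q \<in> tangent_space S q" "(Z has_derivative Z') (at p within S)"
  shows "koszul S g X Y Z p = 2 * G p (Y' (X p)) (Z p)
    + DG p (X p) (Y p) (Z p) + DG p (Y p) (X p) (Z p) - DG p (Z p) (X p) (Y p)"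
proof -
  have D: "differential S (\<lambda>q. g q (V q) (W q)) p u
      = DG p u (V p) (W p) + G p (V' u) (W p) + G p (V p) (W' u)"
    if "\<forall>q\<in>S. V q \<in> tangent_space S q" "\<forall>q\<in>S. W q \<in> tangent_space S q"
      "(V has_derivative V') (at p within S)" "(W has_derivative W') (at p within S)"
      "u \<in> tangent_space S p" for V V' W W' u
    by (rule has_derivative_within_tangent_unique[OF
          has_derivative_transform[OF p _ G_derivative[OF p that(3,4)]] that(5)])
      (simp add: g_eq that)
  have L: "g p (lie_bracket S V W p) u = G p (W' (V p)) u - G p (V' (W p)) u"
    if "\<forall>q\<in>S. V q \<in> tangent_space S q" "\<forall>q\<in>S. W q \<in> tangent_space S q"
      "(V has_derivative V') (at p within S)" "(W has_derivative W') (at p within S)"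
      "u \<in> tangent_space S p" for V V' W W' u
  proof -
    have "lie_bracket S V W p = W' (V p) - V' (W p)"
      using that p by (simp add: lie_bracket_def has_derivative_within_tangent_unique)
    then show ?thesis
      using g_eq[OF p bracket_tangent[OF p that(1-4)] that(5)] by (simp add: G_diff_left)
  qed
  note T = X(1)[rule_format, OF p] Y(1)[rule_format, OF p] Z(1)[rule_format, OF p]
  show ?thesis
    unfolding koszul_def
      D[OF Y(1) Z(1) Y(2) Z(2) T(1)] D[OF X(1) Z(1) X(2) Z(2) T(2)] D[OF X(1) Y(1) X(2) Y(2) T(3)]
      L[OF X(1) Y(1) X(2) Y(2) T(3)] L[OF X(1) Z(1) X(2) Z(2) T(2)] L[OF Y(1) Z(1) Y(2) Z(2) T(1)]
    using G_commute[of p "X p"] G_commute[of p "Y p"] by simp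
qed

text \<open>Nondegeneracy, tested on \<open>v - w\<close>. This is the uniqueness required by
  \<open>THE\<close> in both \<open>gradient\<close> and \<open>levi_civita\<close>.\<close>

lemma tangent_eqI:
  assumes p: "p \<in> S" and "v \<in> tangent_space S p" "w \<in> tangent_space S p"
    and eq: "\<And>x. x \<in> tangent_space S p \<Longrightarrow> g p v x = g p w x"
  shows "v = w"
proof (rule ccontr)
  assume "v \<noteq> w"
  have d: "v - w \<in> tangent_space S p"
    using assms subspace_tangent by (simp add: subspace_diff)
  then have "G p (v - w) (v - w) = 0"
    using eq[OF d] assms by (simp add: g_eq G_diff_left)
  then show False
    using G_pos[OF p, of "v - w"] \<open>v \<noteq> w\<close> by simp
qed

lemma gradient_eqI:
  assumes p: "p \<in> S" and h: "(h has_derivative h') (at p within S)"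
    and w: "w \<in> tangent_space S p" "\<And>v. v \<in> tangent_space S p \<Longrightarrow> G p w v = h' v"
  shows "gradient S g h p = w"
  unfolding gradient_def
proof (rule the_equality)
  show *: "w \<in> tangent_space S p \<and> (\<forall>v\<in>tangent_space S p. g p w v = differential S h p v)"
    using w by (simp add: g_eq[OF p] has_derivative_within_tangent_unique[OF h])
  show "w' = w" if "w' \<in> tangent_space S p \<and> (\<forall>v\<in>tangent_space S p. g p w' v = differential S h p v)" for w'
    using that * by (intro tangent_eqI[OF p]) auto
qed

lemma levi_civita_eqI:
  assumes p: "p \<in> S" and v: "v \<in> tangent_space S p"
    and Y: "\<forall>q\<in>S. Y q \<in> tangent_space S q" "(Y has_derivative Y') (at p within S)"
    and w: "w \<in> tangent_space S p"
    and w_eq: "\<And>x. x \<in> tangent_space S p \<Longrightarrow>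
      2 * G p w x = 2 * G p (Y' v) x + DG p v (Y p) x + DG p (Y p) v x - DG p x v (Y p)"
  shows "levi_civita S g v Y p = w"
  unfolding levi_civita_def
proof (rule the_equality)
  let ?P = "\<lambda>w. w \<in> tangent_space S p \<and> (\<forall>X Z. smooth_vector_field S X \<and>
    smooth_vector_field S Z \<and> X p = v \<longrightarrow> 2 * g p w (Z p) = koszul S g X Y Z p)"
  have "2 * g p w (Z p) = koszul S g X Y Z p"
    if X: "smooth_vector_field S X" and Z: "smooth_vector_field S Z" and "X p = v" for X Z
  proof -
    obtain X' Z' where "(X has_derivative X') (at p within S)" "(Z has_derivative Z') (at p within S)"
      using X Z p by (metis smooth_map_on_has_derivative smooth_vector_field_def)
    then have "koszul S g X Y Z p = 2 * G p (Y' (X p)) (Z p)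
        + DG p (X p) (Y p) (Z p) + DG p (Y p) (X p) (Z p) - DG p (Z p) (X p) (Y p)"
      using X Z by (intro koszul_eq p Y) (auto simp: smooth_vector_field_def)
    then show ?thesis
      using w_eq[of "Z p"] g_eq[OF p w, of "Z p"] Z p \<open>X p = v\<close> by (simp add: smooth_vector_field_def)
  qed
  then show Pw: "?P w"
    using w by blast
  \<comment> \<open>For uniqueness the quantifier over \<open>X\<close> and \<open>Z\<close> must
    not be vacuous: some field extends \<open>v\<close>, and every tangent vector is a value of some
    \<open>Z\<close>.\<close>
  obtain X where X: "smooth_vector_field S X" "X p = v"
    using extension[OF p v] by blast
  show "w' = w" if w': "?P w'" for w'
  proof (rule tangent_eqI[OF p _ w])
    fix x assume "x \<in> tangent_space S p"
    then obtain Z where "smooth_vector_field S Z" "Z p = x"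
      using extension[OF p] by blast
    then have "2 * g p w' x = 2 * g p w x"
      using Pw w' X by metis
    then show "g p w' x = g p w x" by simp
  qed (use w' in blast)
qed

text \<open>\<open>L\<close> has to agree with the covariant derivative only on tangent vectors.
  Being linear on the ambient space with tangent values, it lets the trace be taken over
  \<open>Basis\<close>.\<close>

lemma divergence_eqI:
  assumes p: "p \<in> S"
    and Y: "\<forall>q\<in>S. Y q \<in> tangent_space S q" "(Y has_derivative Y') (at p within S)"
    and L: "linear L" "\<And>v. L v \<in> tangent_space S p"
    and L_eq: "\<And>v x. \<lbrakk>v \<in> tangent_space S p; x \<in> tangent_space S p\<rbrakk> \<Longrightarrow>
      2 * G p (L v) x = 2 * G p (Y' v) x + DG p v (Y p) x + DG p (Y p) v x - DG p x v (Y p)"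
  shows "divergence S g Y p = (\<Sum>i\<in>Basis. L i \<bullet> i)"
  unfolding divergence_def
proof (rule trace_on_eq_sum_Basis[OF subspace_tangent[OF p] L])
  fix v assume "v \<in> tangent_space S p"
  from levi_civita_eqI[OF p this Y L(2) L_eq[OF this]] show "levi_civita S g v Y p = L v" .
qed

end

section \<open>The round sphere\<close>

declare mem_sphere [simp del] mem_sphere_0 [simp del]

lemma C_inf_on_imp_smooth_map_on: "C_inf_on UNIV F \<Longrightarrow> smooth_map_on S F"
  unfolding smooth_map_on_def by blast

text \<open>For a unit vector \<open>p\<close> this is the orthogonal projection onto the hyperplane
  orthogonal to \<open>p\<close>, the tangent space of the sphere at \<open>p\<close>.\<close>

definition sphere_proj :: "'a::real_inner \<Rightarrow> 'a \<Rightarrow> 'a"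
  where "sphere_proj p v = v - (v \<bullet> p) *\<^sub>R p"

lemma inner_self_sphere: "p \<in> sphere 0 1 \<Longrightarrow> p \<bullet> p = (1::real)"
  by (simp add: dot_square_norm mem_sphere_0)

lemma linear_sphere_proj: "linear (sphere_proj p)"
  by (rule linearI) (simp_all add: sphere_proj_def algebra_simps)

lemma sphere_proj_tangent:
  fixes p :: "'a::euclidean_space"
  shows "p \<in> sphere 0 1 \<Longrightarrow> sphere_proj p v \<in> tangent_space (sphere 0 1) p"
  by (simp add: tangent_space_sphere sphere_proj_def inner_simps inner_self_sphere)

lemma sphere_proj_id:
  fixes p :: "'a::euclidean_space"
  shows "p \<in> sphere 0 1 \<Longrightarrow> v \<in> tangent_space (sphere 0 1) p \<Longrightarrow> sphere_proj p v = v"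
  by (simp add: tangent_space_sphere sphere_proj_def)

lemma inner_sphere_proj:
  fixes p :: "'a::euclidean_space"
  shows "p \<in> sphere 0 1 \<Longrightarrow> x \<in> tangent_space (sphere 0 1) p \<Longrightarrow> sphere_proj p v \<bullet> x = v \<bullet> x"
  by (simp add: tangent_space_sphere sphere_proj_def inner_simps inner_commute)

text \<open>The trace of a projection is the dimension of its range; here this is the dimension of
  the sphere, the source of the factors \<open>k\<close> and \<open>l\<close> in the final
  formula.\<close>

lemma trace_sphere_proj:
  fixes p :: "'a::euclidean_space"
  assumes "p \<in> sphere 0 1"
  shows "(\<Sum>i\<in>Basis. sphere_proj p i \<bullet> i) = real DIM('a) - 1"
proof -
  have "(\<Sum>i\<in>Basis. sphere_proj p i \<bullet> i) = (\<Sum>i\<in>Basis. 1 - (p \<bullet> i) * (p \<bullet> i))"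
    by (intro sum.cong) (auto simp: sphere_proj_def inner_simps inner_commute)
  also have "\<dots> = real DIM('a) - p \<bullet> p"
    by (simp add: sum_subtractf euclidean_inner[of p p])
  finally show ?thesis
    by (simp add: inner_self_sphere[OF assms])
qed

lemma C_n_on_sphere_proj:
  assumes "open U" "C_n_on n U F"
  shows "C_n_on n U (\<lambda>x. sphere_proj (F x) v)"
proof -
  have "C_n_on n U (\<lambda>x. v + (v \<bullet> F x) *\<^sub>R (- F x))"
    using assms(1,2)
    by (intro C_n_on_add C_n_on_scaleR C_n_on_const C_n_on_bounded_linear[OF _ bounded_linear_inner_right]
        C_n_on_bounded_linear[OF _ bounded_linear_minus[OF bounded_linear_ident]]) auto
  then show ?thesis
    by (simp add: sphere_proj_def)
qed

text \<open>The normal part of the derivative of a tangent field is symmetric in the direction and the field,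
  hence cancels in the Lie bracket.\<close>

lemma sphere_field_derivative:
  fixes A :: "'a::real_normed_vector \<Rightarrow> 'b::euclidean_space"
  assumes A: "(A has_derivative A') (at p within S)" and X: "(X has_derivative X') (at p within S)"
    and "\<And>q. q \<in> S \<Longrightarrow> X q \<bullet> A q = 0" "p \<in> S" "v \<in> tangent_space S p"
  shows "X' v \<bullet> A p = - (X p \<bullet> A' v)"
proof -
  have "((\<lambda>q. X q \<bullet> A q) has_derivative (\<lambda>h. X p \<bullet> A' h + X' h \<bullet> A p)) (at p within S)"
    by (rule has_derivative_inner[OF X A])
  moreover have "((\<lambda>q. X q \<bullet> A q) has_derivative (\<lambda>h. 0)) (at p within S)"
    by (rule has_derivative_transform[OF assms(4) _ has_derivative_const[of 0]]) (simp add: assms(3))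
  ultimately have "X p \<bullet> A' v + X' v \<bullet> A p = 0"
    by (rule trans[OF has_derivative_within_tangent_unique[OF _ assms(5), symmetric]
          has_derivative_within_tangent_unique[OF _ assms(5)]])
  then show ?thesis by simp
qed

interpretation sphere: embedded_riemannian "sphere (0::'a::euclidean_space) 1" "\<lambda>p v w. v \<bullet> w" "\<lambda>p v w. v \<bullet> w"
  "\<lambda>p h v w. 0"
proof
  fix p :: 'a and v w v' X Y X' Y'
  show "v \<bullet> w = v \<bullet> w" "v \<bullet> w = w \<bullet> v" "(v - v') \<bullet> w = v \<bullet> w - v' \<bullet> w" for v w v' :: 'a
    by (auto simp: inner_commute inner_simps)
  show "v \<bullet> v > 0" if "v \<noteq> 0" for v :: 'a using that by simp
  assume p: "p \<in> sphere 0 1"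
  show "subspace (tangent_space (sphere 0 1) p)"
    unfolding tangent_space_sphere[OF p] by (auto simp: subspace_def inner_simps)
  show "((\<lambda>q. V q \<bullet> W q) has_derivative (\<lambda>h. 0 + V' h \<bullet> W p + V p \<bullet> W' h)) (at p within sphere 0 1)"
    if "(V has_derivative V') (at p within sphere 0 1)" "(W has_derivative W') (at p within sphere 0 1)"
    for V W V' W' :: "'a \<Rightarrow> 'a"
    using has_derivative_inner[OF that] by (simp add: add.commute)
  show "\<exists>X. smooth_vector_field (sphere 0 1) X \<and> X p = v" if "v \<in> tangent_space (sphere 0 1) p" for v
  proof -
    \<comment> \<open>The extension of \<open>v\<close> is the tangential part of the constant field
      \<open>v\<close>.\<close>
    have "C_inf_on UNIV (\<lambda>q::'a. sphere_proj q v)"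
      by (simp add: C_inf_on_def C_n_on_sphere_proj C_n_on_ident)
    then have "smooth_map_on (sphere 0 1) (\<lambda>q. sphere_proj q v)"
      by (rule C_inf_on_imp_smooth_map_on)
    then show ?thesis
      using sphere_proj_tangent sphere_proj_id[OF p that] unfolding smooth_vector_field_def by blast
  qed
  fix X Y X' Y' :: "'a \<Rightarrow> 'a"
  assume XY: "\<forall>q\<in>sphere 0 1. X q \<in> tangent_space (sphere 0 1) q"
      "\<forall>q\<in>sphere 0 1. Y q \<in> tangent_space (sphere 0 1) q"
      "(X has_derivative X') (at p within sphere 0 1)" "(Y has_derivative Y') (at p within sphere 0 1)"
  have n: "X q \<bullet> q = 0" "Y q \<bullet> q = 0" if "q \<in> sphere 0 1" for q
    using XY(1,2) that tangent_space_sphere[OF that] by auto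
  \<comment> \<open>With the identity as \<open>A\<close>, both \<open>Y' (X p)\<close> and
    \<open>X' (Y p)\<close> have normal component \<open>- (X p \<bullet> Y p)\<close>.\<close>
  show "Y' (X p) - X' (Y p) \<in> tangent_space (sphere 0 1) p"
    unfolding tangent_space_sphere[OF p]
    using sphere_field_derivative[OF has_derivative_ident XY(3) n(1) p XY(2)[rule_format, OF p]]
      sphere_field_derivative[OF has_derivative_ident XY(4) n(2) p XY(1)[rule_format, OF p]]
    by (simp add: inner_diff_left inner_diff_right inner_commute)
qed

text \<open>The field is the gradient of a smooth extension near \<open>p\<close> and an arbitrary pointwise choice
  elsewhere: its derivative is controlled only at \<open>p\<close>, but no neighbourhoods are needed later.\<close>

lemma smooth_map_on_gradient_field:
  fixes h :: "'a::euclidean_space \<Rightarrow> real"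
  assumes h: "smooth_map_on S h" and p: "p \<in> S"
  obtains N N' where "\<And>q. q \<in> S \<Longrightarrow> (h has_derivative (\<lambda>v. N q \<bullet> v)) (at q within S)"
    and "(N has_derivative N') (at p)"
proof -
  have grad: "(F has_derivative (\<lambda>v. (\<Sum>i\<in>Basis. F' i *\<^sub>R i) \<bullet> v)) X"
    if "(F has_derivative F') X" for F F' :: "'a \<Rightarrow> real" and X
  proof -
    have "F' v = (\<Sum>i\<in>Basis. F' i *\<^sub>R i) \<bullet> v" for v
    proof -
      have "F' v = F' (\<Sum>i\<in>Basis. (v \<bullet> i) *\<^sub>R i)"
        by (simp add: euclidean_representation)
      also have "\<dots> = (\<Sum>i\<in>Basis. (v \<bullet> i) * F' i)"
        using has_derivative_linear[OF that] by (simp add: linear_sum linear_cmul)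
      finally show ?thesis
        by (simp add: inner_sum_left inner_commute[of v] mult.commute)
    qed
    then have "F' = (\<lambda>v. (\<Sum>i\<in>Basis. F' i *\<^sub>R i) \<bullet> v)"
      by (rule ext)
    with that show ?thesis by simp
  qed
  obtain U F where U: "open U" "p \<in> U" "C_inf_on U F" "\<And>q. q \<in> U \<inter> S \<Longrightarrow> F q = h q"
    using h p by (auto simp: smooth_map_on_def)
  have "C_n_on (Suc (Suc 0)) U F"
    using U(3) unfolding C_inf_on_def by blast
  note F = C_n_on_SucD(1)[OF this] C_n_on_SucD(1)[OF C_n_on_SucD(2)[OF this]]
  define N0 where "N0 q = (\<Sum>i\<in>Basis. frechet_derivative F (at q) i *\<^sub>R i)" for q
  define N where "N q = (if q \<in> U then N0 q else (SOME n. (h has_derivative (\<lambda>v. n \<bullet> v)) (at q within S)))" for q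
  show ?thesis
  proof
    fix q assume q: "q \<in> S"
    show "(h has_derivative (\<lambda>v. N q \<bullet> v)) (at q within S)"
    proof (cases "q \<in> U")
      case True
      have "(F has_derivative (\<lambda>v. N q \<bullet> v)) (at q within S)"
        using grad[OF F(1)[OF True]] True by (simp add: N_def N0_def has_derivative_at_withinI)
      moreover have "eventually (\<lambda>q. F q = h q) (at q within S)"
        using U True by (auto simp: eventually_at_topological)
      ultimately show ?thesis
        by (rule has_derivative_transform_eventually) (use U(4) True q in auto)
    next
      case False
      obtain h' where "(h has_derivative h') (at q within S)"
        using smooth_map_on_has_derivative[OF h q] by blast
      from someI[of "\<lambda>n. (h has_derivative (\<lambda>v. n \<bullet> v)) (at q within S)", OF grad[OF this]] False
      show ?thesis by (simp add: N_def)
    qed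
  next
    have "(N0 has_derivative (\<lambda>v. \<Sum>i\<in>Basis. frechet_derivative (\<lambda>q. frechet_derivative F (at q) i) (at p) v *\<^sub>R i)) (at p)"
      unfolding N0_def by (intro has_derivative_sum has_derivative_scaleR_left F(2) U(2))
    then show "(N has_derivative (\<lambda>v. \<Sum>i\<in>Basis. frechet_derivative (\<lambda>q. frechet_derivative F (at q) i) (at p) v *\<^sub>R i)) (at p)"
      by (rule has_derivative_transform_within_open[OF _ U(1,2)]) (simp add: N_def)
  qed
qed

text \<open>The flat inner product has zero derivative, so the covariant derivative is the
  tangential part of the ambient derivative, and the gradient is the tangential part of
  \<open>n\<close>. Projecting the argument as well makes the map linear on the ambient space
  without changing it on tangent vectors.\<close>

lemma sphere_laplacian_eq:
  fixes \<eta> :: "'a::euclidean_space \<Rightarrow> real"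
  assumes y: "y \<in> sphere 0 1"
    and \<eta>: "\<And>q. q \<in> sphere 0 1 \<Longrightarrow> (\<eta> has_derivative (\<lambda>v. n q \<bullet> v)) (at q within sphere 0 1)"
    and K: "((\<lambda>q. sphere_proj q (n q)) has_derivative K') (at y within sphere 0 1)"
  shows "sphere_laplacian \<eta> y = (\<Sum>i\<in>Basis. sphere_proj y (K' (sphere_proj y i)) \<bullet> i)"
proof -
  let ?Y = "gradient (sphere 0 1) (\<lambda>p v w. v \<bullet> w) \<eta>"
  have grad: "?Y q = sphere_proj q (n q)" if q: "q \<in> sphere 0 1" for q
    by (rule sphere.gradient_eqI[OF q \<eta>[OF q] sphere_proj_tangent[OF q]])
      (rule inner_sphere_proj[OF q])
  have lin: "linear K'"
    using K by (rule has_derivative_linear)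
  show ?thesis
    unfolding sphere_laplacian_def laplacian_def
  proof (rule sphere.divergence_eqI[OF y])
    show "\<forall>q\<in>sphere 0 1. ?Y q \<in> tangent_space (sphere 0 1) q"
      using grad sphere_proj_tangent by metis
    show "(?Y has_derivative K') (at y within sphere 0 1)"
      by (rule has_derivative_transform[OF y grad K])
    show "linear (\<lambda>i. sphere_proj y (K' (sphere_proj y i)))"
      using linear_compose[OF linear_compose[OF linear_sphere_proj lin] linear_sphere_proj]
      by (simp add: o_def)
  qed (simp_all add: sphere_proj_tangent y sphere_proj_id inner_sphere_proj)
qed

section \<open>Warped products of two spheres and a line\<close>

text \<open>Defined on all ambient vectors, since Koszul terms involve derivatives that are not
  tangent. No sign is imposed on the coefficients: with \<open>a'\<close>, \<open>b'\<close>,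
  \<open>c'\<close> the same form serves as the derivative of the metric in
  \<open>u\<close>.\<close>

definition warped_metric ::
  "(real \<Rightarrow> real) \<Rightarrow> (real \<Rightarrow> real) \<Rightarrow> (real \<Rightarrow> real) \<Rightarrow> ('a::euclidean_space \<times> 'b::euclidean_space \<times> real) metric_tensor"
where
  "warped_metric a b c = (\<lambda>(y, z, u) (v1, v2, s) (w1, w2, t).
     a u * (v1 \<bullet> w1) + b u * (v2 \<bullet> w2) + c u * (s * t))"

lemma tangent_space_sphere_cylinder:
  "tangent_space (sphere 0 1 \<times> sphere 0 1 \<times> UNIV) (y, z, u) =
    tangent_space (sphere 0 1) y \<times> tangent_space (sphere 0 1) z \<times> UNIV"
  by (simp add: tangent_space_Times tangent_space_UNIV)

text \<open>The library version \<open>sum_Basis_prod_eq\<close> only covers summands in the product space itself.\<close>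

lemma sum_Basis_prod:
  fixes f :: "'a::euclidean_space \<times> 'b::euclidean_space \<Rightarrow> 'c::comm_monoid_add"
  shows "sum f Basis = (\<Sum>i\<in>Basis. f (i, 0)) + (\<Sum>i\<in>Basis. f (0, i))"
proof -
  have "inj_on (\<lambda>u. (u::'a, 0::'b)) Basis" "inj_on (\<lambda>u. (0::'a, u::'b)) Basis"
    by (auto simp: inj_on_def)
  then show ?thesis
    unfolding Basis_prod_def by (subst sum.union_disjoint) (auto simp: sum.reindex)
qed

lemma has_derivative_height:
  fixes e :: "real \<Rightarrow> real" and S :: "('a::real_normed_vector \<times> 'b::real_normed_vector \<times> real) set"
  assumes "(e has_real_derivative D) (at u)"
  shows "((\<lambda>q. e (snd (snd q))) has_derivative (\<lambda>h. snd (snd h) * D)) (at (y, z, u) within S)"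
proof -
  have "((\<lambda>q. snd (snd q)) has_derivative (\<lambda>h. snd (snd h))) (at (y, z, u) within S)"
    by (intro derivative_intros)
  moreover have "(e has_derivative (\<lambda>h. h * D)) (at (snd (snd (y, z, u))))"
    using assms by (simp add: has_field_derivative_def mult_commute_abs)
  ultimately show ?thesis
    by (rule has_derivative_compose[where g = e])
qed

text \<open>\<open>g\<close> is prescribed only on tangent vectors, because elsewhere the value of
  an induced metric depends on the choice made by \<open>frechet_derivative\<close>.\<close>

locale warped_spheres =
  fixes g :: "('a::euclidean_space \<times> 'b::euclidean_space \<times> real) metric_tensor"
    and a b c a' b' c' :: "real \<Rightarrow> real"
  assumes pos: "a u > 0" "b u > 0" "c u > 0"
    and deriv: "(a has_real_derivative a' u) (at u)" "(b has_real_derivative b' u) (at u)"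
      "(c has_real_derivative c' u) (at u)"
    and metric: "\<lbrakk>p \<in> sphere 0 1 \<times> sphere 0 1 \<times> UNIV;
        v \<in> tangent_space (sphere 0 1 \<times> sphere 0 1 \<times> UNIV) p;
        w \<in> tangent_space (sphere 0 1 \<times> sphere 0 1 \<times> UNIV) p\<rbrakk>
      \<Longrightarrow> g p v w = warped_metric a b c p v w"
begin

abbreviation M :: "('a \<times> 'b \<times> real) set"
  where "M \<equiv> sphere 0 1 \<times> sphere 0 1 \<times> UNIV"

text \<open>With the vectors held fixed, the form varies with the base point only through
  \<open>u\<close>; its derivative is therefore the height component of the direction times the form
  with differentiated coefficients.\<close>

sublocale embedded_riemannian M g "warped_metric a b c"
  "\<lambda>p h v w. snd (snd h) * warped_metric a' b' c' p v w"
proof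
  fix p v w v' :: "'a \<times> 'b \<times> real"
  show "warped_metric a b c p v w = warped_metric a b c p w v"
    by (simp add: warped_metric_def split_beta inner_commute mult.commute)
  show "warped_metric a b c p (v - v') w = warped_metric a b c p v w - warped_metric a b c p v' w"
    by (simp add: warped_metric_def split_beta inner_diff_left algebra_simps)
  assume p: "p \<in> M"
  obtain y z u where yzu: "p = (y, z, u)" "y \<in> sphere 0 1" "z \<in> sphere 0 1"
    using p by auto
  show "g p v w = warped_metric a b c p v w" if "v \<in> tangent_space M p" "w \<in> tangent_space M p"
    by (rule metric[OF p that])
  show "subspace (tangent_space M p)"
    using sphere.subspace_tangent[OF yzu(2)] sphere.subspace_tangent[OF yzu(3)] yzu(1)
    by (auto simp: tangent_space_sphere_cylinder intro!: subspace_Times)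
  show "0 < warped_metric a b c p v v" if "v \<noteq> 0"
  proof -
    obtain v1 v2 s where v: "v = (v1, v2, s)" by (cases v)
    have "0 \<le> a u * (v1 \<bullet> v1)" "0 \<le> b u * (v2 \<bullet> v2)" "0 \<le> c u * (s * s)"
      using pos[of u] by (simp_all add: less_imp_le)
    moreover have "0 < a u * (v1 \<bullet> v1) \<or> 0 < b u * (v2 \<bullet> v2) \<or> 0 < c u * (s * s)"
      using that pos[of u] v by (auto simp: zero_prod_def zero_less_mult_iff linorder_neq_iff)
    ultimately show ?thesis
      by (auto simp: warped_metric_def yzu v)
  qed
  show "\<exists>X. smooth_vector_field M X \<and> X p = v" if v: "v \<in> tangent_space M p"
  proof -
    obtain v1 v2 s where vs: "v = (v1, v2, s)" by (cases v)
    \<comment> \<open>Constant vectors, projected in each sphere factor; the line component needs no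
      correction.\<close>
    define X where "X q = (sphere_proj (fst q) v1, sphere_proj (fst (snd q)) v2, s)" for q :: "'a \<times> 'b \<times> real"
    have "C_n_on n UNIV (\<lambda>q::'a \<times> 'b \<times> real. fst q)" "C_n_on n UNIV (\<lambda>q::'a \<times> 'b \<times> real. fst (snd q))" for n
      by (rule C_n_on_bounded_linear[OF open_UNIV bounded_linear_fst C_n_on_ident[OF open_UNIV]]
          C_n_on_bounded_linear[OF open_UNIV bounded_linear_fst
            C_n_on_bounded_linear[OF open_UNIV bounded_linear_snd C_n_on_ident[OF open_UNIV]]])+
    then have "C_inf_on UNIV X"
      unfolding X_def C_inf_on_def
      by (intro allI C_n_on_Pair C_n_on_sphere_proj C_n_on_const) auto
    then have "smooth_vector_field M X"
      unfolding smooth_vector_field_def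
      by (auto simp: X_def tangent_space_sphere_cylinder C_inf_on_imp_smooth_map_on sphere_proj_tangent)
    moreover have "X p = v"
      using v yzu by (simp add: X_def vs tangent_space_sphere_cylinder sphere_proj_id)
    ultimately show ?thesis by blast
  qed
  show "Y' (X p) - X' (Y p) \<in> tangent_space M p"
    if X: "\<forall>q\<in>M. X q \<in> tangent_space M q" and Y: "\<forall>q\<in>M. Y q \<in> tangent_space M q"
      and X': "(X has_derivative X') (at p within M)" and Y': "(Y has_derivative Y') (at p within M)"
    for X Y X' Y'
  proof -
    have n: "fst (X q) \<bullet> fst q = 0" "fst (snd (X q)) \<bullet> fst (snd q) = 0"
      if "q \<in> M" "\<forall>q\<in>M. X q \<in> tangent_space M q" for q and X :: "'a \<times> 'b \<times> real \<Rightarrow> 'a \<times> 'b \<times> real"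
      using that by (force simp: tangent_space_sphere_cylinder tangent_space_sphere mem_Times_iff)+
    note Xp = bspec[OF X p] and Yp = bspec[OF Y p]
    \<comment> \<open>The argument for one sphere is repeated in each sphere factor, with the
      coordinate map of that factor as \<open>A\<close>; along the line every vector is
      tangent.\<close>
    have "fst (X' (Y p)) \<bullet> fst p = - (fst (X p) \<bullet> fst (Y p))"
      by (rule sphere_field_derivative[OF _ _ n(1)[OF _ X] p Yp]) (auto intro!: derivative_intros X')
    moreover have "fst (Y' (X p)) \<bullet> fst p = - (fst (Y p) \<bullet> fst (X p))"
      by (rule sphere_field_derivative[OF _ _ n(1)[OF _ Y] p Xp]) (auto intro!: derivative_intros Y')
    moreover have "fst (snd (X' (Y p))) \<bullet> fst (snd p) = - (fst (snd (X p)) \<bullet> fst (snd (Y p)))"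
      by (rule sphere_field_derivative[OF _ _ n(2)[OF _ X] p Yp]) (auto intro!: derivative_intros X')
    moreover have "fst (snd (Y' (X p))) \<bullet> fst (snd p) = - (fst (snd (Y p)) \<bullet> fst (snd (X p)))"
      by (rule sphere_field_derivative[OF _ _ n(2)[OF _ Y] p Xp]) (auto intro!: derivative_intros Y')
    ultimately show ?thesis
      using yzu by (simp add: tangent_space_sphere_cylinder tangent_space_sphere mem_Times_iff
          inner_diff_left inner_diff_right inner_commute)
  qed
  show "((\<lambda>q. warped_metric a b c q (V q) (W q)) has_derivative
      (\<lambda>h. snd (snd h) * warped_metric a' b' c' p (V p) (W p)
        + warped_metric a b c p (V' h) (W p) + warped_metric a b c p (V p) (W' h))) (at p within M)"
    if V: "(V has_derivative V') (at p within M)" and W: "(W has_derivative W') (at p within M)"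
    for V W V' W'
  proof -
    note u = deriv[THEN has_derivative_height, of u y z M]
    show ?thesis
      unfolding warped_metric_def split_beta yzu(1)
      by (rule derivative_eq_intros u V[unfolded yzu(1)] W[unfolded yzu(1)] refl)+
        (simp add: fun_eq_iff algebra_simps)
  qed
qed

text \<open>Each factor contributes the divergence of its own component of \<open>Y\<close>. The
  variation of the metric adds half the logarithmic derivative of each coefficient, times the
  dimension of its factor, times the height component of \<open>Y\<close>.\<close>

lemma divergence_eq:
  assumes p: "p = (y, z, u)" "p \<in> M"
    and Y: "\<forall>q\<in>M. Y q \<in> tangent_space M q" "(Y has_derivative Y') (at p within M)"
  shows "divergence M g Y p =
      (\<Sum>i\<in>Basis. sphere_proj y (fst (Y' (sphere_proj y i, 0, 0))) \<bullet> i)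
    + (\<Sum>i\<in>Basis. sphere_proj z (fst (snd (Y' (0, sphere_proj z i, 0)))) \<bullet> i)
    + snd (snd (Y' (0, 0, 1)))
    + (real (DIM('a) - 1) * (a' u / (2 * a u)) + real (DIM('b) - 1) * (b' u / (2 * b u)) + c' u / (2 * c u))
        * snd (snd (Y p))"
proof -
  have yz: "y \<in> sphere 0 1" "z \<in> sphere 0 1" using p by auto
  obtain Y1 Y2 Y3 where Yp: "Y p = (Y1, Y2, Y3)" by (cases "Y p")
  have lin: "linear Y'" using Y(2) by (rule has_derivative_linear)
  have P: "sphere_proj q (x + x') = sphere_proj q x + sphere_proj q x'"
    "sphere_proj q (r *\<^sub>R x) = r *\<^sub>R sphere_proj q x" "sphere_proj q 0 = 0"
    for q x x' r
    by (simp_all add: linear_add linear_cmul linear_0 linear_sphere_proj)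
  \<comment> \<open>Orthogonal projection onto the tangent space at \<open>p\<close>. It must
    precede \<open>C\<close>, since the terms \<open>Y3 *\<^sub>R fst v\<close> and
    \<open>Y3 *\<^sub>R fst (snd v)\<close> are tangent only for tangent \<open>v\<close>.\<close>
  define proj where "proj v = (sphere_proj y (fst v), sphere_proj z (fst (snd v)), snd (snd v))"
    for v :: "'a \<times> 'b \<times> real"
  \<comment> \<open>Obtained by solving the Koszul equation for the unknown vector: test vectors in
    a single factor isolate the corresponding component.\<close>
  define C where "C v =
    (sphere_proj y (fst (Y' v)) + (a' u / (2 * a u)) *\<^sub>R (snd (snd v) *\<^sub>R Y1 + Y3 *\<^sub>R fst v),
     sphere_proj z (fst (snd (Y' v))) + (b' u / (2 * b u)) *\<^sub>R (snd (snd v) *\<^sub>R Y2 + Y3 *\<^sub>R fst (snd v)),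
     snd (snd (Y' v)) + c' u / (2 * c u) * (snd (snd v) * Y3)
       - (a' u * (fst v \<bullet> Y1) + b' u * (fst (snd v) \<bullet> Y2)) / (2 * c u))" for v :: "'a \<times> 'b \<times> real"
  have "linear proj"
    by (rule linearI) (simp_all add: proj_def P)
  moreover have "linear C"
    by (rule linearI) (simp_all add: C_def P linear_add[OF lin] linear_cmul[OF lin] inner_simps algebra_simps
        add_divide_distrib diff_divide_distrib)
  ultimately have linL: "linear (\<lambda>v. C (proj v))"
    using linear_compose by (auto simp: o_def)
  have Ytan: "Y1 \<in> tangent_space (sphere 0 1) y" "Y2 \<in> tangent_space (sphere 0 1) z"
    using bspec[OF Y(1) p(2)] unfolding Yp by (simp_all add: p(1) tangent_space_sphere_cylinder)
  have Ltan: "C (proj v) \<in> tangent_space M p" for v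
    using sphere.subspace_tangent[OF yz(1)] sphere.subspace_tangent[OF yz(2)] Ytan
    by (simp add: p(1) C_def proj_def tangent_space_sphere_cylinder sphere_proj_tangent yz subspace_add subspace_scale)
  have Leq: "2 * warped_metric a b c p (C (proj v)) x = 2 * warped_metric a b c p (Y' v) x
      + snd (snd v) * warped_metric a' b' c' p (Y p) x + snd (snd (Y p)) * warped_metric a' b' c' p v x
      - snd (snd x) * warped_metric a' b' c' p v (Y p)"
    if v: "v \<in> tangent_space M p" and x: "x \<in> tangent_space M p" for v x
  proof -
    obtain x1 x2 t where xs: "x = (x1, x2, t)" by (cases x)
    obtain v1 v2 s where vs: "v = (v1, v2, s)" by (cases v)
    have "proj v = v"
      using v yz by (auto simp: p(1) proj_def vs tangent_space_sphere_cylinder sphere_proj_id)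
    moreover have "sphere_proj y e \<bullet> x1 = e \<bullet> x1" "sphere_proj z e' \<bullet> x2 = e' \<bullet> x2" for e e'
      using x yz by (auto simp: p(1) xs tangent_space_sphere_cylinder inner_sphere_proj)
    ultimately show ?thesis
      using pos[of u]
      by (simp add: C_def warped_metric_def p(1) xs vs Yp[unfolded p(1)] split_beta inner_simps field_simps)
  qed
  have "divergence M g Y p = (\<Sum>i\<in>Basis. C (proj i) \<bullet> i)"
    by (rule divergence_eqI[OF p(2) Y linL Ltan Leq])
  \<comment> \<open>The trace sees only the diagonal blocks, so the mixed terms of \<open>C\<close>
    drop out.\<close>
  also have "\<dots> = (\<Sum>i\<in>Basis. fst (C (proj (i, 0))) \<bullet> i) + (\<Sum>i\<in>Basis. fst (snd (C (proj (0, i, 0)))) \<bullet> i)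
      + snd (snd (C (proj (0, 0, 1))))"
    unfolding sum_Basis_prod by (simp add: inner_prod_def zero_prod_def)
  also have "(\<Sum>i\<in>Basis. fst (C (proj (i, 0))) \<bullet> i) =
      (\<Sum>i\<in>Basis. sphere_proj y (fst (Y' (sphere_proj y i, 0, 0))) \<bullet> i)
      + a' u / (2 * a u) * Y3 * (\<Sum>i\<in>Basis. sphere_proj y i \<bullet> i)"
    by (simp add: C_def proj_def P inner_add_left sum.distrib sum_distrib_left)
  also have "(\<Sum>i\<in>Basis. fst (snd (C (proj (0, i, 0)))) \<bullet> i) =
      (\<Sum>i\<in>Basis. sphere_proj z (fst (snd (Y' (0, sphere_proj z i, 0)))) \<bullet> i)
      + b' u / (2 * b u) * Y3 * (\<Sum>i\<in>Basis. sphere_proj z i \<bullet> i)"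
    by (simp add: C_def proj_def P inner_add_left sum.distrib sum_distrib_left)
  also have "snd (snd (C (proj (0, 0, 1)))) = snd (snd (Y' (0, 0, 1))) + c' u / (2 * c u) * Y3"
    by (simp add: C_def proj_def P)
  finally show ?thesis
    by (simp add: trace_sphere_proj yz Yp of_nat_diff algebra_simps)
qed

text \<open>The sign of the \<open>c'\<close> term: the divergence contributes
  \<open>c' / (2 * c)\<close>, while differentiating the factor \<open>1 / c\<close> of the gradient
  contributes \<open>- c' / c\<close>.\<close>

lemma laplacian_eq:
  assumes \<zeta>: "smooth_map_on M \<zeta>" and p: "(y, z, u) \<in> M"
  shows "laplacian M g \<zeta> (y, z, u) =
      sphere_laplacian (\<lambda>y'. \<zeta> (y', z, u)) y / a u + sphere_laplacian (\<lambda>z'. \<zeta> (y, z', u)) z / b u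
    + (deriv (deriv (\<lambda>s. \<zeta> (y, z, s))) u
       + (real (DIM('a) - 1) * (a' u / (2 * a u)) + real (DIM('b) - 1) * (b' u / (2 * b u))
          - c' u / (2 * c u)) * deriv (\<lambda>s. \<zeta> (y, z, s)) u) / c u"
proof -
  let ?p = "(y, z, u)"
  have yz: "y \<in> sphere 0 1" "z \<in> sphere 0 1" using p by auto
  obtain N N' where N: "\<And>q. q \<in> M \<Longrightarrow> (\<zeta> has_derivative (\<lambda>v. N q \<bullet> v)) (at q within M)"
    and N': "(N has_derivative N') (at ?p)"
    using smooth_map_on_gradient_field[OF \<zeta> p] by metis
  have slice: "((\<lambda>x. \<zeta> (j x)) has_derivative (\<lambda>v. N (j x) \<bullet> j' v)) (at x within R)"
    if "x \<in> R" "\<And>x. x \<in> R \<Longrightarrow> j x \<in> M" "(j has_derivative j') (at x within R)" for j j' x R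
    by (rule has_derivative_in_compose2[where t = M, OF N image_subsetI[OF that(2)] that(1,3)])
  \<comment> \<open>The components of the gradient before division by the metric coefficients: the
    two sphere gradients of the slices and the derivative in \<open>u\<close>.\<close>
  define K1 where "K1 q = sphere_proj (fst q) (fst (N q))" for q
  define K2 where "K2 q = sphere_proj (fst (snd q)) (fst (snd (N q)))" for q
  define K3 where "K3 q = snd (snd (N q))" for q
  \<comment> \<open>Existence is enough: the same \<open>K1'\<close> appears in the divergence on
    \<open>M\<close> and in the sphere Laplacian of the slice, and likewise for
    \<open>K2'\<close>.\<close>
  have "\<exists>D. (K1 has_derivative D) (at ?p)"
    unfolding K1_def sphere_proj_def
    by (rule exI, (rule has_derivative_diff has_derivative_scaleR has_derivative_inner has_derivative_fst
        has_derivative_ident N')+)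
  then obtain K1' where K1': "(K1 has_derivative K1') (at ?p)" ..
  have "\<exists>D. (K2 has_derivative D) (at ?p)"
    unfolding K2_def sphere_proj_def
    by (rule exI, (rule has_derivative_diff has_derivative_scaleR has_derivative_inner has_derivative_fst
        has_derivative_snd has_derivative_ident N')+)
  then obtain K2' where K2': "(K2 has_derivative K2') (at ?p)" ..
  obtain K3' where K3': "(K3 has_derivative K3') (at ?p)"
    unfolding K3_def using has_derivative_snd[OF has_derivative_snd[OF N']] by blast
  define Y where "Y q = (K1 q /\<^sub>R a (snd (snd q)), K2 q /\<^sub>R b (snd (snd q)), K3 q / c (snd (snd q)))" for q
  have grad: "gradient M g \<zeta> q = Y q" if q: "q \<in> M" for q
  proof (rule gradient_eqI[OF q N[OF q]])
    obtain y z u where yzu: "q = (y, z, u)" "y \<in> sphere 0 1" "z \<in> sphere 0 1" using q by auto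
    show "Y q \<in> tangent_space M q"
      using yzu by (simp add: Y_def K1_def K2_def tangent_space_sphere_cylinder sphere_proj_tangent
          subspace_scale sphere.subspace_tangent)
    fix v assume "v \<in> tangent_space M q"
    then show "warped_metric a b c q (Y q) v = N q \<bullet> v"
      using yzu pos[of u] by (cases v, cases "N q")
        (simp add: Y_def K1_def K2_def K3_def warped_metric_def tangent_space_sphere_cylinder inner_sphere_proj
          field_simps)
  qed
  note u = deriv[THEN has_derivative_height, of u y z UNIV]
  define Y' where "Y' h =
    (K1' h /\<^sub>R a u - (snd (snd h) * a' u / (a u)\<^sup>2) *\<^sub>R K1 ?p,
     K2' h /\<^sub>R b u - (snd (snd h) * b' u / (b u)\<^sup>2) *\<^sub>R K2 ?p,
     K3' h / c u - snd (snd h) * c' u / (c u)\<^sup>2 * K3 ?p)" for h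
  have Yd: "(Y has_derivative Y') (at ?p)"
    unfolding Y_def Y'_def
    using pos[of u] by (auto intro!: derivative_eq_intros K1' K2' K3' u
        simp: fun_eq_iff power2_eq_square field_simps)
  have Y': "(gradient M g \<zeta> has_derivative Y') (at ?p within M)"
    by (rule has_derivative_transform[OF p grad has_derivative_at_withinI[OF Yd]])
  have tan: "\<forall>q\<in>M. gradient M g \<zeta> q \<in> tangent_space M q"
  proof
    fix q assume q: "q \<in> M"
    then obtain y z u where "q = (y, z, u)" "y \<in> sphere 0 1" "z \<in> sphere 0 1" by auto
    then show "gradient M g \<zeta> q \<in> tangent_space M q"
      unfolding grad[OF q] by (simp add: Y_def K1_def K2_def tangent_space_sphere_cylinder sphere_proj_tangent
          subspace_scale sphere.subspace_tangent)
  qed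
  \<comment> \<open>On the slice with \<open>z\<close> and \<open>u\<close> fixed, \<open>K1\<close>
    is the sphere gradient of the restricted function, and its derivative is \<open>K1'\<close> on
    vectors \<open>(v, 0, 0)\<close>.\<close>
  have lap1: "sphere_laplacian (\<lambda>y'. \<zeta> (y', z, u)) y = (\<Sum>i\<in>Basis. sphere_proj y (K1' (sphere_proj y i, 0, 0)) \<bullet> i)"
  proof (rule sphere_laplacian_eq[OF yz(1)])
    show "((\<lambda>y'. \<zeta> (y', z, u)) has_derivative (\<lambda>v. fst (N (q, z, u)) \<bullet> v)) (at q within sphere 0 1)"
      if "q \<in> sphere 0 1" for q
    proof -
      have "((\<lambda>q. (q, z, u)) has_derivative (\<lambda>v. (v, 0, 0))) (at q within sphere 0 1)"
        by (intro has_derivative_Pair has_derivative_ident has_derivative_const)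
      from slice[OF that _ this] show ?thesis
        using yz by (simp add: inner_prod_def)
    qed
    have "((\<lambda>q. K1 (q, z, u)) has_derivative (\<lambda>v. K1' (v, 0, 0))) (at y within sphere 0 1)"
      by (rule has_derivative_compose[where f = "\<lambda>q. (q, z, u)", OF _ K1']) (intro has_derivative_Pair has_derivative_ident has_derivative_const)
    then show "((\<lambda>q. sphere_proj q (fst (N (q, z, u)))) has_derivative (\<lambda>v. K1' (v, 0, 0))) (at y within sphere 0 1)"
      by (simp add: K1_def)
  qed
  have lap2: "sphere_laplacian (\<lambda>z'. \<zeta> (y, z', u)) z = (\<Sum>i\<in>Basis. sphere_proj z (K2' (0, sphere_proj z i, 0)) \<bullet> i)"
  proof (rule sphere_laplacian_eq[OF yz(2)])
    show "((\<lambda>z'. \<zeta> (y, z', u)) has_derivative (\<lambda>v. fst (snd (N (y, q, u))) \<bullet> v)) (at q within sphere 0 1)"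
      if "q \<in> sphere 0 1" for q
    proof -
      have "((\<lambda>q. (y, q, u)) has_derivative (\<lambda>v. (0, v, 0))) (at q within sphere 0 1)"
        by (intro has_derivative_Pair has_derivative_ident has_derivative_const)
      from slice[OF that _ this] show ?thesis
        using yz by (simp add: inner_prod_def)
    qed
    have "((\<lambda>q. K2 (y, q, u)) has_derivative (\<lambda>v. K2' (0, v, 0))) (at z within sphere 0 1)"
      by (rule has_derivative_compose[where f = "\<lambda>q. (y, q, u)", OF _ K2']) (intro has_derivative_Pair has_derivative_ident has_derivative_const)
    then show "((\<lambda>q. sphere_proj q (fst (snd (N (y, q, u))))) has_derivative (\<lambda>v. K2' (0, v, 0))) (at z within sphere 0 1)"
      by (simp add: K2_def)
  qed
  \<comment> \<open>Needed at every \<open>s\<close>, so that \<open>d1\<close> is an equality of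
    functions that can be differentiated again.\<close>
  have "((\<lambda>s. \<zeta> (y, z, s)) has_derivative (*) (K3 (y, z, s))) (at s)" for s
  proof -
    have "((\<lambda>s. (y, z, s)) has_derivative (\<lambda>v. (0, 0, v))) (at s)"
      by (intro has_derivative_Pair has_derivative_ident has_derivative_const)
    from slice[OF UNIV_I _ this] show ?thesis
      using yz by (simp add: inner_prod_def K3_def)
  qed
  then have d1: "deriv (\<lambda>s. \<zeta> (y, z, s)) = (\<lambda>s. K3 (y, z, s))"
    by (intro ext DERIV_imp_deriv) (simp add: has_field_derivative_def)
  have "((\<lambda>s. K3 (y, z, s)) has_derivative (\<lambda>v. K3' (0, 0, v))) (at u)"
    by (rule has_derivative_compose[where f = "\<lambda>q. (y, z, q)", OF _ K3']) (intro has_derivative_Pair has_derivative_ident has_derivative_const)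
  moreover have "(\<lambda>v. K3' (0, 0, v)) = (*) (K3' (0, 0, 1))"
  proof
    show "K3' (0, 0, v) = K3' (0, 0, 1) * v" for v
      using linear_cmul[OF has_derivative_linear[OF K3'], of v "(0, 0, 1)"] by (simp add: mult.commute)
  qed
  ultimately have d2: "deriv (\<lambda>s. K3 (y, z, s)) u = K3' (0, 0, 1)"
    by (intro DERIV_imp_deriv) (simp add: has_field_derivative_def)
  have P: "sphere_proj q (x /\<^sub>R r) \<bullet> i = sphere_proj q x \<bullet> i / r" for q x r i
    by (simp add: linear_cmul[OF linear_sphere_proj] divide_inverse)
  \<comment> \<open>In the sphere directions the height component vanishes, so \<open>1 / a\<close>
    and \<open>1 / b\<close> behave as constants; only \<open>1 / c\<close> is
    differentiated.\<close>
  show ?thesis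
    unfolding laplacian_def divergence_eq[OF refl p tan Y'] lap1 lap2 d1 d2
    using pos[of u]
    by (simp add: Y'_def grad[OF p] P sum_divide_distrib) (simp add: Y_def field_simps power2_eq_square)
qed

end

section \<open>The metric induced by \<open>\<phi>\<close> and the resulting formula\<close>

theorem lemma4p1:
  fixes k l :: nat and T :: real
    and f1 f2 f :: "real \<Rightarrow> real"
    and M :: "('a::euclidean_space \<times> 'b::euclidean_space \<times> real) set"
    and \<phi> :: "'a \<times> 'b \<times> real \<Rightarrow> 'a \<times> 'b \<times> real"
    and \<zeta> :: "'a \<times> 'b \<times> real \<Rightarrow> real"
  assumes "k \<ge> 1" and "l \<ge> 1"
    and "DIM('a) = k + 1" and "DIM('b) = l + 1"
    and "T > 0"
    and "C_inf_on UNIV f1" and "C_inf_on UNIV f2"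
    and "\<And>u. f1 (u + T) = f1 u" and "\<And>u. f2 (u + T) = f2 u"
    and "\<And>u. (deriv f1 u)\<^sup>2 + (deriv f2 u)\<^sup>2 = 1"
    and "\<And>u. f2 u > 0"
    and "\<And>u. (f1 u)\<^sup>2 + (f2 u)\<^sup>2 < 1"
    and "f = (\<lambda>u. sqrt (1 - (f1 u)\<^sup>2 - (f2 u)\<^sup>2))"
    and "M = sphere 0 1 \<times> sphere 0 1 \<times> UNIV"
    and "\<phi> = (\<lambda>(y, z, u). (f u *\<^sub>R y, f2 u *\<^sub>R z, f1 u))"
    and "smooth_map_on M \<zeta>"
    and "\<And>y z u. (y, z, u) \<in> M \<Longrightarrow> \<zeta> (y, z, u + T) = \<zeta> (y, z, u)"
    and "(y, z, u) \<in> M"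
  shows "laplacian M (induced_metric M \<phi>) \<zeta> (y, z, u) =
      sphere_laplacian (\<lambda>y'. \<zeta> (y', z, u)) y / (f u)\<^sup>2
    + 1 / (1 + (deriv f u)\<^sup>2) *
        ((real k * (deriv f u / f u) + real l * (deriv f2 u / f2 u)
            - deriv f u * deriv (deriv f) u / (1 + (deriv f u)\<^sup>2))
           * deriv (\<lambda>s. \<zeta> (y, z, s)) u
         + deriv (deriv (\<lambda>s. \<zeta> (y, z, s))) u)
    + sphere_laplacian (\<lambda>z'. \<zeta> (y, z', u)) z / (f2 u)\<^sup>2"
proof -
  note f1 = C_inf_on_has_real_derivative[OF \<open>C_inf_on UNIV f1\<close>]
  note f2 = C_inf_on_has_real_derivative[OF \<open>C_inf_on UNIV f2\<close>]
  have unit: "(deriv f1 u)\<^sup>2 + (deriv f2 u)\<^sup>2 = 1" and f2_pos: "f2 u > 0" for u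
    using assms(10,11) by auto
  have r_pos: "1 - (f1 u)\<^sup>2 - (f2 u)\<^sup>2 > 0" for u
    using assms(12)[of u] by simp
  then have f_pos: "f u > 0" for u
    by (simp add: assms(13))
  define D where "D u = - (f1 u * deriv f1 u + f2 u * deriv f2 u) / f u" for u
  have fD: "(f has_real_derivative D u) (at u)" for u
    unfolding D_def assms(13) using r_pos[of u]
    by (auto intro!: derivative_eq_intros f1 f2 simp: field_simps)
  then have D: "deriv f = D"
    by (intro ext DERIV_imp_deriv)
  have f_deriv: "(f has_real_derivative deriv f u) (at u)" for u
    using fD by (simp add: D)
  \<comment> \<open>Existence suffices, as the formula keeps the value in the form
    \<open>deriv (deriv f) u\<close>. Positivity of \<open>f\<close> makes the quotient
    differentiable.\<close>
  have "\<exists>E. (D has_real_derivative E) (at u)" for u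
    unfolding D_def
    by (rule exI, (rule DERIV_divide DERIV_minus DERIV_add DERIV_mult f1 f2 fD)+)
      (use f_pos[of u] in simp)
  then have f_deriv2: "(deriv f has_real_derivative deriv (deriv f) u) (at u)" for u
    unfolding D by (metis DERIV_imp_deriv)
  interpret warped_spheres "induced_metric M \<phi>" "\<lambda>u. (f u)\<^sup>2" "\<lambda>u. (f2 u)\<^sup>2" "\<lambda>u. 1 + (deriv f u)\<^sup>2"
    "\<lambda>u. 2 * f u * deriv f u" "\<lambda>u. 2 * f2 u * deriv f2 u" "\<lambda>u. 2 * deriv f u * deriv (deriv f) u"
  proof
    fix u
    show "(f u)\<^sup>2 > 0" "(f2 u)\<^sup>2 > 0" "1 + (deriv f u)\<^sup>2 > 0"
      using f_pos[of u] f2_pos[of u] by (auto simp: add_pos_nonneg)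
    show "((\<lambda>u. (f u)\<^sup>2) has_real_derivative 2 * f u * deriv f u) (at u)"
      "((\<lambda>u. (f2 u)\<^sup>2) has_real_derivative 2 * f2 u * deriv f2 u) (at u)"
      "((\<lambda>u. 1 + (deriv f u)\<^sup>2) has_real_derivative 2 * deriv f u * deriv (deriv f) u) (at u)"
      by (auto intro!: derivative_eq_intros f_deriv f_deriv2 f2)
  next
    fix p v w :: "'a \<times> 'b \<times> real"
    assume p: "p \<in> sphere 0 1 \<times> sphere 0 1 \<times> UNIV"
      and v: "v \<in> tangent_space (sphere 0 1 \<times> sphere 0 1 \<times> UNIV) p"
      and w: "w \<in> tangent_space (sphere 0 1 \<times> sphere 0 1 \<times> UNIV) p"
    obtain y z u where yzu: "p = (y, z, u)" "y \<in> sphere 0 1" "z \<in> sphere 0 1" using p by auto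
    obtain v1 v2 s where vs: "v = (v1, v2, s)" by (cases v)
    obtain w1 w2 t where ws: "w = (w1, w2, t)" by (cases w)
    define \<phi>' where "\<phi>' h = (f u *\<^sub>R fst h + (snd (snd h) * deriv f u) *\<^sub>R y,
      f2 u *\<^sub>R fst (snd h) + (snd (snd h) * deriv f2 u) *\<^sub>R z, snd (snd h) * deriv f1 u)"
      for h :: "'a \<times> 'b \<times> real"
    have "((\<lambda>q. (f (snd (snd q)) *\<^sub>R fst q, f2 (snd (snd q)) *\<^sub>R fst (snd q), f1 (snd (snd q)))) has_derivative \<phi>')
        (at p within M)"
      unfolding \<phi>'_def yzu(1)
      by (rule derivative_eq_intros has_derivative_height f_deriv f2(1) f1(1) refl)+ simp
    then have "(\<phi> has_derivative \<phi>') (at p within M)"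
      unfolding assms(15) case_prod_beta .
    then have "induced_metric M \<phi> p v w = \<phi>' v \<bullet> \<phi>' w"
      using v w by (simp add: induced_metric_def has_derivative_within_tangent_unique assms(14))
    moreover have "v1 \<bullet> y = 0" "v2 \<bullet> z = 0" "y \<bullet> w1 = 0" "z \<bullet> w2 = 0"
      using v w yzu by (simp_all add: inner_commute[of y] inner_commute[of z] vs ws tangent_space_sphere_cylinder tangent_space_sphere)
    \<comment> \<open>The mixed terms vanish because tangent vectors are orthogonal to
      \<open>y\<close> and \<open>z\<close>; as these are unit vectors, the height parts add up to
      the squared speed of \<open>(f, f2, f1)\<close>, in which the unit speed condition leaves
      \<open>1 + (deriv f u)\<^sup>2\<close>.\<close>
    ultimately have "induced_metric M \<phi> p v w = (f u)\<^sup>2 * (v1 \<bullet> w1) + (f2 u)\<^sup>2 * (v2 \<bullet> w2)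
        + s * t * ((deriv f u)\<^sup>2 + ((deriv f1 u)\<^sup>2 + (deriv f2 u)\<^sup>2))"
      by (simp add: \<phi>'_def vs ws inner_add_left inner_add_right
          inner_self_sphere yzu(2,3) algebra_simps power2_eq_square)
    then show "induced_metric M \<phi> p v w = warped_metric (\<lambda>u. (f u)\<^sup>2) (\<lambda>u. (f2 u)\<^sup>2) (\<lambda>u. 1 + (deriv f u)\<^sup>2) p v w"
      by (simp add: warped_metric_def yzu vs ws unit algebra_simps)
  qed
  have k: "real (DIM('a) - 1) = real k" "real (DIM('b) - 1) = real l"
    using assms(3,4) by auto
  \<comment> \<open>Half the logarithmic derivative of a squared radius is the logarithmic
    derivative of the radius.\<close>
  have quot: "2 * f u * deriv f u / (2 * (f u)\<^sup>2) = deriv f u / f u"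
    "2 * f2 u * deriv f2 u / (2 * (f2 u)\<^sup>2) = deriv f2 u / f2 u"
    using f_pos[of u] f2_pos[of u] by (simp_all add: power2_eq_square)
  have quot': "2 * deriv f u * deriv (deriv f) u / (2 * (1 + (deriv f u)\<^sup>2))
      = deriv f u * deriv (deriv f) u / (1 + (deriv f u)\<^sup>2)"
    unfolding mult.assoc by (rule mult_divide_mult_cancel_left) simp
  show ?thesis
    using laplacian_eq[of \<zeta> y z u] assms(16,18)
    unfolding assms(14)[symmetric] quot quot' k
    by (simp add: add_ac)
qed

end
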